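(* Free triassociative algebras (over a field $K$) are rigid.
   Context: All vector spaces and tensor products are over a fixed field $K$. A triassociative algebra is a vector space $A$ with three bilinear operations $L=\dashv$, $R=\vdash$, $M=\bot$ satisfying, for all $x,y,z$, the following $11$ conditions: (1) $L(L(x,y),z)=L(x,L(y,z))$; (2) $L(L(x,y),z)=L(x,R(y,z))$; (3) $L(R(x,y),z)=R(x,L(y,z))$; (4) $R(L(x,y),z)=R(x,R(y,z))$; (5) $R(R(x,y),z)=R(x,R(y,z))$; (6) $L(L(x,y),z)=L(x,M(y,z))$; (7) $L(M(x,y),z)=M(x,L(y,z))$; (8) $M(L(x,y),z)=M(x,R(y,z))$; (9) $M(R(x,y),z)=R(x,M(y,z))$; (10) $R(M(x,y),z)=R(x,R(y,z))$; (11) $M(M(x,y),z)=M(x,M(y,z))$, where $L(x,y)=x\dashv y$, etc. Morphisms are linear maps respecting the three products; free triassociative algebras are free (on a vector space) in this category. A deformation of $A$ is a power series $\Theta_t=\sum_{i=0}^\infty\theta_it^i$ in which each $\theta_i=(\lambda_i,\rho_i,\mu_i)$ is a triple of bilinear operations $A\otimes A\to A$ and $\theta_0=(\dashv,\vdash,\bot)$, such that $L_t=\sum\lambda_it^i$, $R_t=\sum\rho_it^i$, $M_t=\sum\mu_it^i$ satisfy conditions (1)-(11) (with $L_t,R_t,M_t$ in place of $L,R,M$, extended linearly to power series) for all $x,y,z\in A$. A formal isomorphism of $A$ is a power series $\Phi_t=\sum_{i=0}^\infty\phi_it^i$ with $\phi_i\in\mathrm{Hom}_K(A,A)$ and $\phi_0=\mathrm{Id}_A$.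 Deformations $\Theta_t=(L_t,R_t,M_t)$ and $\overline\Theta_t=(\overline L_t,\overline R_t,\overline M_t)$ are equivalent if there is a formal isomorphism $\Phi_t$ with $\overline O_t(x,y)=\Phi_tO_t(\Phi_t^{-1}(x),\Phi_t^{-1}(y))$ for $O=L,R,M$ and all $x,y\in A$. The trivial deformation is $\Theta_t=(\dashv,\vdash,\bot)t^0$. $A$ is rigid if every deformation of $A$ is equivalent to the trivial deformation. *)

theory Defs
  imports Complex_Main "HOL-Library.Poly_Mapping"
    "HOL-Computational_Algebra.Formal_Power_Series"
begin

section \<open>Triassociative algebras\<close>

text \<open>
  The eleven identities, for arguments from a set \<open>S\<close>. The set is a parameter because the same
  identities are imposed on \<open>A[[t]]\<close>, but there only for arguments from \<open>A\<close>.
\<close>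

definition triassociative_on ::
  "'b set \<Rightarrow> ('b \<Rightarrow> 'b \<Rightarrow> 'b) \<Rightarrow> ('b \<Rightarrow> 'b \<Rightarrow> 'b) \<Rightarrow> ('b \<Rightarrow> 'b \<Rightarrow> 'b) \<Rightarrow> bool" where
  "triassociative_on S L R M \<longleftrightarrow>
    (\<forall>x\<in>S. \<forall>y\<in>S. \<forall>z\<in>S.
      L (L x y) z = L x (L y z) \<and>
      L (L x y) z = L x (R y z) \<and>
      L (R x y) z = R x (L y z) \<and>
      R (L x y) z = R x (R y z) \<and>
      R (R x y) z = R x (R y z) \<and>
      L (L x y) z = L x (M y z) \<and>
      L (M x y) z = M x (L y z) \<and>
      M (L x y) z = M x (R y z) \<and>
      M (R x y) z = R x (M y z) \<and>
      R (M x y) z = R x (R y z) \<and>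
      M (M x y) z = M x (M y z))"

definition bilinear_op ::
  "('k::field \<Rightarrow> 'a::ab_group_add \<Rightarrow> 'a) \<Rightarrow> ('a \<Rightarrow> 'a \<Rightarrow> 'a) \<Rightarrow> bool" where
  "bilinear_op s B \<longleftrightarrow>
    (\<forall>x. Vector_Spaces.linear s s (\<lambda>y. B x y)) \<and> (\<forall>y. Vector_Spaces.linear s s (\<lambda>x. B x y))"

definition triassociative_algebra ::
  "('k::field \<Rightarrow> 'a::ab_group_add \<Rightarrow> 'a) \<Rightarrow>
   ('a \<Rightarrow> 'a \<Rightarrow> 'a) \<Rightarrow> ('a \<Rightarrow> 'a \<Rightarrow> 'a) \<Rightarrow> ('a \<Rightarrow> 'a \<Rightarrow> 'a) \<Rightarrow> bool" where
  "triassociative_algebra s L R M \<longleftrightarrow>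
    vector_space s \<and> bilinear_op s L \<and> bilinear_op s R \<and> bilinear_op s M \<and>
    triassociative_on UNIV L R M"

definition triassociative_hom ::
  "('k::field \<Rightarrow> 'a::ab_group_add \<Rightarrow> 'a) \<Rightarrow>
   ('a \<Rightarrow> 'a \<Rightarrow> 'a) \<Rightarrow> ('a \<Rightarrow> 'a \<Rightarrow> 'a) \<Rightarrow> ('a \<Rightarrow> 'a \<Rightarrow> 'a) \<Rightarrow>
   ('k \<Rightarrow> 'b::ab_group_add \<Rightarrow> 'b) \<Rightarrow>
   ('b \<Rightarrow> 'b \<Rightarrow> 'b) \<Rightarrow> ('b \<Rightarrow> 'b \<Rightarrow> 'b) \<Rightarrow> ('b \<Rightarrow> 'b \<Rightarrow> 'b) \<Rightarrow> ('a \<Rightarrow> 'b) \<Rightarrow> bool" where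
  "triassociative_hom s L R M s' L' R' M' g \<longleftrightarrow>
    Vector_Spaces.linear s s' g \<and>
    (\<forall>x y. g (L x y) = L' (g x) (g y)) \<and>
    (\<forall>x y. g (R x y) = R' (g x) (g y)) \<and>
    (\<forall>x y. g (M x y) = M' (g x) (g y))"


section \<open>Free triassociative algebras\<close>

text \<open>
  The universal property of \<open>i : V \<rightarrow> A\<close> with respect to all triassociative algebras whose
  underlying type is \<open>'c\<close>.
\<close>

definition universal_at ::
  "'c::ab_group_add itself \<Rightarrow> ('k::field \<Rightarrow> 'v::ab_group_add \<Rightarrow> 'v) \<Rightarrow>
   ('k \<Rightarrow> 'a::ab_group_add \<Rightarrow> 'a) \<Rightarrow>
   ('a \<Rightarrow> 'a \<Rightarrow> 'a) \<Rightarrow> ('a \<Rightarrow> 'a \<Rightarrow> 'a) \<Rightarrow> ('a \<Rightarrow> 'a \<Rightarrow> 'a) \<Rightarrow> ('v \<Rightarrow> 'a) \<Rightarrow> bool" where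
  "universal_at (_ :: 'c itself) sV s L R M i \<longleftrightarrow>
    (\<forall>(s' :: 'k \<Rightarrow> 'c \<Rightarrow> 'c) L' R' M' f.
      triassociative_algebra s' L' R' M' \<longrightarrow> Vector_Spaces.linear sV s' f \<longrightarrow>
      (\<exists>!g. triassociative_hom s L R M s' L' R' M' g \<and> (\<forall>v. g (i v) = f v)))"

datatype 'v tri_monomial =
    Gen 'v
  | LProd "'v tri_monomial" "'v tri_monomial"
  | RProd "'v tri_monomial" "'v tri_monomial"
  | MProd "'v tri_monomial" "'v tri_monomial"

text \<open>
  \<open>(A, i)\<close> is free on \<open>V\<close> if it has the universal property with respect to every triassociative
  algebra over \<open>K\<close>. A definition cannot quantify over types, so two types of target algebras are
  singled out: that of \<open>A\<close> itself, and that of the finite formal \<open>K\<close>-linear combinations of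
  nonassociative monomials in elements of \<open>V\<close>. The latter is large enough for every algebra
  generated by an image of \<open>V\<close>. Nothing is lost: \<open>free_imp_universal_at\<close> below derives
  the universal property at an arbitrary type.
\<close>

definition free_triassociative_algebra ::
  "('k::field \<Rightarrow> 'v::ab_group_add \<Rightarrow> 'v) \<Rightarrow> ('k \<Rightarrow> 'a::ab_group_add \<Rightarrow> 'a) \<Rightarrow>
   ('a \<Rightarrow> 'a \<Rightarrow> 'a) \<Rightarrow> ('a \<Rightarrow> 'a \<Rightarrow> 'a) \<Rightarrow> ('a \<Rightarrow> 'a \<Rightarrow> 'a) \<Rightarrow> ('v \<Rightarrow> 'a) \<Rightarrow> bool" where
  "free_triassociative_algebra sV s L R M i \<longleftrightarrow>
    triassociative_algebra s L R M \<and> Vector_Spaces.linear sV s i \<and>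
    universal_at TYPE('a) sV s L R M i \<and>
    universal_at TYPE('v tri_monomial \<Rightarrow>\<^sub>0 'k) sV s L R M i"

primrec mono_val ::
  "('c \<Rightarrow> 'c \<Rightarrow> 'c) \<Rightarrow> ('c \<Rightarrow> 'c \<Rightarrow> 'c) \<Rightarrow> ('c \<Rightarrow> 'c \<Rightarrow> 'c) \<Rightarrow> ('v \<Rightarrow> 'c) \<Rightarrow> 'v tri_monomial \<Rightarrow> 'c" where
  "mono_val L R M f (Gen v) = f v"
| "mono_val L R M f (LProd m n) = L (mono_val L R M f m) (mono_val L R M f n)"
| "mono_val L R M f (RProd m n) = R (mono_val L R M f m) (mono_val L R M f n)"
| "mono_val L R M f (MProd m n) = M (mono_val L R M f m) (mono_val L R M f n)"

definition comb_scale :: "'k::field \<Rightarrow> ('m \<Rightarrow>\<^sub>0 'k) \<Rightarrow> ('m \<Rightarrow>\<^sub>0 'k)" where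
  "comb_scale c w = Poly_Mapping.map ((*) c) w"

definition comb_val ::
  "('k::field \<Rightarrow> 'c::ab_group_add \<Rightarrow> 'c) \<Rightarrow> ('m \<Rightarrow> 'c) \<Rightarrow> ('m \<Rightarrow>\<^sub>0 'k) \<Rightarrow> 'c" where
  "comb_val s val w = (\<Sum>m\<in>Poly_Mapping.keys w. s (Poly_Mapping.lookup w m) (val m))"

lemma lookup_comb_scale [simp]:
  "Poly_Mapping.lookup (comb_scale c w) m = c * Poly_Mapping.lookup w m"
  by (simp add: comb_scale_def Poly_Mapping.map.rep_eq when_def)

lemma vector_space_comb_scale: "vector_space comb_scale"
  by unfold_locales (rule poly_mapping_eqI, simp add: lookup_add algebra_simps)+

lemma comb_val_superset:
  assumes "vector_space s" "finite X" "Poly_Mapping.keys w \<subseteq> X"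
  shows "comb_val s val w = (\<Sum>m\<in>X. s (Poly_Mapping.lookup w m) (val m))"
proof -
  interpret vector_space s by fact
  show ?thesis unfolding comb_val_def
    by (rule sum.mono_neutral_left) (use assms in \<open>auto simp: in_keys_iff\<close>)
qed

lemma linear_comb_val:
  assumes "vector_space s"
  shows "Vector_Spaces.linear comb_scale s (comb_val s val)"
proof -
  interpret vector_space s by fact
  have "comb_val s val (u + w) = comb_val s val u + comb_val s val w" for u w
  proof -
    let ?X = "Poly_Mapping.keys u \<union> Poly_Mapping.keys w"
    have k: "Poly_Mapping.keys (u + w) \<subseteq> ?X" by (rule Poly_Mapping.keys_add)
    have "comb_val s val z = (\<Sum>m\<in>?X. s (Poly_Mapping.lookup z m) (val m))"
      if "z \<in> {u, w, u + w}" for z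
      by (rule comb_val_superset) (use that assms k in auto)
    then show ?thesis
      by (simp add: lookup_add scale_left_distrib sum.distrib)
  qed
  moreover have "comb_val s val (comb_scale c w) = s c (comb_val s val w)" for c w
  proof -
    have "comb_val s val (comb_scale c w) =
        (\<Sum>m\<in>Poly_Mapping.keys w. s (Poly_Mapping.lookup (comb_scale c w) m) (val m))"
      by (rule comb_val_superset) (use assms in \<open>auto simp: in_keys_iff\<close>)
    then show ?thesis by (simp add: comb_val_def scale_sum_right)
  qed
  ultimately show ?thesis
    using assms vector_space_comb_scale by (simp add: Vector_Spaces.linear_iff)
qed

lemma comb_val_single:
  assumes "vector_space s"
  shows "comb_val s val (Poly_Mapping.single m 1) = val m"
proof -
  interpret vector_space s by fact
  show ?thesis by (simp add: comb_val_def)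
qed

lemma linear_sum_scale:
  assumes "Vector_Spaces.linear s s' g"
  shows "g (\<Sum>m\<in>X. s (c m) (h m)) = (\<Sum>m\<in>X. s' (c m) (g (h m)))"
proof -
  interpret Vector_Spaces.linear s s' g by fact
  show ?thesis by (simp add: sum scale)
qed

lemma range_comb_val_closed:
  assumes vs: "vector_space s" and B: "bilinear_op s B"
    and val: "\<And>m n. val (P m n) = B (val m) (val n)"
  shows "B (comb_val s val u) (comb_val s val w) \<in> range (comb_val s val)"
proof -
  interpret vector_space s by fact
  interpret p: Vector_Spaces.linear comb_scale s "comb_val s val"
    by (rule linear_comb_val) fact
  have sub: "subspace (range (comb_val s val))"
    using p.subspace_image[OF p.vs1.subspace_UNIV] .
  have l1: "Vector_Spaces.linear s s (\<lambda>x. B x y)" and l2: "Vector_Spaces.linear s s (\<lambda>y. B x y)" for x y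
    using B by (auto simp: bilinear_op_def)
  have "B (comb_val s val u) (comb_val s val w) =
    (\<Sum>m\<in>Poly_Mapping.keys u. s (Poly_Mapping.lookup u m)
      (\<Sum>n\<in>Poly_Mapping.keys w. s (Poly_Mapping.lookup w n) (val (P m n))))"
  proof -
    have e1: "B (comb_val s val u) z =
        (\<Sum>m\<in>Poly_Mapping.keys u. s (Poly_Mapping.lookup u m) (B (val m) z))" for z
      unfolding comb_val_def by (rule linear_sum_scale[OF l1])
    have e2: "B z (comb_val s val w) =
        (\<Sum>n\<in>Poly_Mapping.keys w. s (Poly_Mapping.lookup w n) (B z (val n)))" for z
      unfolding comb_val_def by (rule linear_sum_scale[OF l2])
    show ?thesis by (simp only: e1) (simp only: e2 val)
  qed
  moreover have "val m \<in> range (comb_val s val)" for m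
    using comb_val_single[OF vs, of val m] by (metis rangeI)
  ultimately show ?thesis
    by (auto intro!: subspace_sum[OF sub] subspace_scale[OF sub])
qed

text \<open>
  Existence of extensions at an arbitrary type: the subalgebra generated by \<open>f V\<close> is transported
  along a linear section of the evaluation of formal combinations of monomials.
\<close>

lemma universal_at_extension:
  fixes sV :: "'k::field \<Rightarrow> 'v::ab_group_add \<Rightarrow> 'v" and sC :: "'k \<Rightarrow> 'c::ab_group_add \<Rightarrow> 'c"
  assumes U: "universal_at TYPE('v tri_monomial \<Rightarrow>\<^sub>0 'k) sV s L R M i"
    and C: "triassociative_algebra sC LC RC MC" and f: "Vector_Spaces.linear sV sC f"
  obtains g where "triassociative_hom s L R M sC LC RC MC g" "\<And>v. g (i v) = f v"
    "range g \<subseteq> range (comb_val sC (mono_val LC RC MC f))"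
proof -
  define val where "val = mono_val LC RC MC f"
  define p where "p = comb_val sC val"
  have vs: "vector_space sC"
    and bl: "bilinear_op sC LC" "bilinear_op sC RC" "bilinear_op sC MC"
    and tri: "triassociative_on UNIV LC RC MC"
    using C by (auto simp: triassociative_algebra_def)
  have lp: "Vector_Spaces.linear comb_scale sC p"
    unfolding p_def by (rule linear_comb_val) fact
  interpret p: Vector_Spaces.linear comb_scale sC p by (rule lp)
  interpret vp: vector_space_pair "comb_scale :: 'k \<Rightarrow> ('v tri_monomial \<Rightarrow>\<^sub>0 'k) \<Rightarrow> _" sC
    by (rule vector_space_pair.intro[OF vector_space_comb_scale vs])
  obtain t where lt: "Vector_Spaces.linear sC comb_scale t" and pt: "\<And>y. y \<in> range p \<Longrightarrow> p (t y) = y"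
    using vp.linear_exists_right_inverse_on[OF lp p.vs1.subspace_UNIV] by auto
  have cl: "LC (p x) (p y) \<in> range p" "RC (p x) (p y) \<in> range p" "MC (p x) (p y) \<in> range p" for x y
    unfolding p_def
    using range_comb_val_closed[OF vs bl(1), where P = LProd and val = val]
      range_comb_val_closed[OF vs bl(2), where P = RProd and val = val]
      range_comb_val_closed[OF vs bl(3), where P = MProd and val = val]
    by (simp_all add: val_def)
  have fr: "f v \<in> range p" for v
    using comb_val_single[OF vs, of val "Gen v"] by (metis mono_val.simps(1) p_def rangeI val_def)
  define W where "W = (\<lambda>B x y. t (B (p x) (p y)))"
  have bW: "bilinear_op comb_scale (W B)" if "bilinear_op sC B" for B
    using that lp lt unfolding bilinear_op_def W_def by (simp add: Vector_Spaces.linear_iff)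
  have pW: "p (W LC x y) = LC (p x) (p y)" "p (W RC x y) = RC (p x) (p y)"
    "p (W MC x y) = MC (p x) (p y)" for x y
    using cl pt by (auto simp: W_def)
  have "triassociative_on UNIV (W LC) (W RC) (W MC)"
  proof -
    have pt': "p (t (LC (p x) (p y))) = LC (p x) (p y)" "p (t (RC (p x) (p y))) = RC (p x) (p y)"
      "p (t (MC (p x) (p y))) = MC (p x) (p y)" for x y
      using cl pt by auto
    show ?thesis unfolding triassociative_on_def
    proof (intro ballI)
      fix x y z
      note tri' = tri[unfolded triassociative_on_def, rule_format, OF UNIV_I UNIV_I UNIV_I,
          of "p x" "p y" "p z"]
      show "W LC (W LC x y) z = W LC x (W LC y z) \<and>
        W LC (W LC x y) z = W LC x (W RC y z) \<and>
        W LC (W RC x y) z = W RC x (W LC y z) \<and>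
        W RC (W LC x y) z = W RC x (W RC y z) \<and>
        W RC (W RC x y) z = W RC x (W RC y z) \<and>
        W LC (W LC x y) z = W LC x (W MC y z) \<and>
        W LC (W MC x y) z = W MC x (W LC y z) \<and>
        W MC (W LC x y) z = W MC x (W RC y z) \<and>
        W MC (W RC x y) z = W RC x (W MC y z) \<and>
        W RC (W MC x y) z = W RC x (W RC y z) \<and>
        W MC (W MC x y) z = W MC x (W MC y z)"
        unfolding W_def pt'
        by (intro conjI; rule arg_cong[where f = t]; insert tri'; elim conjE; assumption)
    qed
  qed
  then have "triassociative_algebra comb_scale (W LC) (W RC) (W MC)"
    using bW bl vector_space_comb_scale by (auto simp: triassociative_algebra_def)
  moreover have "Vector_Spaces.linear sV comb_scale (\<lambda>v. t (f v))"
    using f lt by (simp add: Vector_Spaces.linear_iff)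
  ultimately obtain h where h: "triassociative_hom s L R M comb_scale (W LC) (W RC) (W MC) h"
      "\<And>v. h (i v) = t (f v)"
    using U unfolding universal_at_def by metis
  show thesis
  proof (rule that)
    show "triassociative_hom s L R M sC LC RC MC (\<lambda>x. p (h x))"
      using h(1) lp unfolding triassociative_hom_def by (simp add: pW Vector_Spaces.linear_iff)
    show "p (h (i v)) = f v" for v using h(2) pt fr by simp
    show "range (\<lambda>x. p (h x)) \<subseteq> range (comb_val sC (mono_val LC RC MC f))"
      unfolding p_def val_def by auto
  qed
qed

lemma hom_mono_val:
  assumes "triassociative_hom s L R M s' L' R' M' g"
  shows "g (mono_val L R M i m) = mono_val L' R' M' (\<lambda>v. g (i v)) m"
  by (induction m) (use assms in \<open>simp_all add: triassociative_hom_def\<close>)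

theorem free_imp_universal_at:
  fixes sV :: "'k::field \<Rightarrow> 'v::ab_group_add \<Rightarrow> 'v" and s :: "'k \<Rightarrow> 'a::ab_group_add \<Rightarrow> 'a"
  assumes F: "free_triassociative_algebra sV s L R M i"
  shows "universal_at TYPE('c::ab_group_add) sV s L R M i"
proof -
  have A: "triassociative_algebra s L R M" and li: "Vector_Spaces.linear sV s i"
    and UA: "universal_at TYPE('a) sV s L R M i"
    and UW: "universal_at TYPE('v tri_monomial \<Rightarrow>\<^sub>0 'k) sV s L R M i"
    using F by (auto simp: free_triassociative_algebra_def)
  have vs: "vector_space s" using A by (simp add: triassociative_algebra_def)
  have gen: "x \<in> range (comb_val s (mono_val L R M i))" for x
  proof -
    obtain g where g: "triassociative_hom s L R M s L R M g" "\<And>v. g (i v) = i v"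
        "range g \<subseteq> range (comb_val s (mono_val L R M i))"
      using universal_at_extension[OF UW A li] by metis
    have id: "triassociative_hom s L R M s L R M (\<lambda>x. x)"
      using vs by (simp add: triassociative_hom_def Vector_Spaces.linear_iff)
    have "g = (\<lambda>x. x)"
      using UA[unfolded universal_at_def, rule_format, OF A li] g(1,2) id by blast
    then show ?thesis using g(3) by auto
  qed
  show ?thesis unfolding universal_at_def
  proof (intro allI impI)
    fix s' :: "'k \<Rightarrow> 'c \<Rightarrow> 'c" and L' R' M' f
    assume C: "triassociative_algebra s' L' R' M'" and f: "Vector_Spaces.linear sV s' f"
    obtain g where g: "triassociative_hom s L R M s' L' R' M' g" "\<And>v. g (i v) = f v"
      using universal_at_extension[OF UW C f] by metis
    show "\<exists>!g. triassociative_hom s L R M s' L' R' M' g \<and> (\<forall>v. g (i v) = f v)"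
    proof (rule ex1I[of _ g])
      show "triassociative_hom s L R M s' L' R' M' g \<and> (\<forall>v. g (i v) = f v)" using g by simp
      fix h assume h: "triassociative_hom s L R M s' L' R' M' h \<and> (\<forall>v. h (i v) = f v)"
      show "h = g"
      proof
        fix x
        obtain w where x: "x = comb_val s (mono_val L R M i) w" using gen by blast
        have "k x = comb_val s' (mono_val L' R' M' f) w"
          if k: "triassociative_hom s L R M s' L' R' M' k" "\<And>v. k (i v) = f v" for k
        proof -
          have "Vector_Spaces.linear s s' k" using k(1) by (simp add: triassociative_hom_def)
          then show ?thesis
            by (simp add: x comb_val_def linear_sum_scale hom_mono_val[OF k(1)] k(2))
        qed
        from this[of h] this[of g] show "h x = g x" using h g by simp
      qed
    qed
  qed
qed


section \<open>Deformations and rigidity\<close>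

text \<open>
  The product on \<open>A[[t]]\<close> determined by a power series of bilinear operations on \<open>A\<close>.
  Elements of \<open>A[[t]]\<close> are of type \<open>'a fps\<close>, and \<open>fps_const\<close> is the inclusion of \<open>A\<close>.
\<close>

definition series_op ::
  "(nat \<Rightarrow> 'a \<Rightarrow> 'a \<Rightarrow> 'a) \<Rightarrow> 'a::ab_group_add fps \<Rightarrow> 'a fps \<Rightarrow> 'a fps" where
  "series_op \<theta> f g =
    Abs_fps (\<lambda>n. \<Sum>i\<le>n. \<Sum>j\<le>n - i. \<theta> i (fps_nth f j) (fps_nth g (n - i - j)))"

definition deformation ::
  "('k::field \<Rightarrow> 'a::ab_group_add \<Rightarrow> 'a) \<Rightarrow>
   ('a \<Rightarrow> 'a \<Rightarrow> 'a) \<Rightarrow> ('a \<Rightarrow> 'a \<Rightarrow> 'a) \<Rightarrow> ('a \<Rightarrow> 'a \<Rightarrow> 'a) \<Rightarrow>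
   (nat \<Rightarrow> 'a \<Rightarrow> 'a \<Rightarrow> 'a) \<Rightarrow> (nat \<Rightarrow> 'a \<Rightarrow> 'a \<Rightarrow> 'a) \<Rightarrow> (nat \<Rightarrow> 'a \<Rightarrow> 'a \<Rightarrow> 'a) \<Rightarrow> bool" where
  "deformation s L R M lam rho mu \<longleftrightarrow>
    (\<forall>n. bilinear_op s (lam n) \<and> bilinear_op s (rho n) \<and> bilinear_op s (mu n)) \<and>
    lam 0 = L \<and> rho 0 = R \<and> mu 0 = M \<and>
    triassociative_on (range fps_const) (series_op lam) (series_op rho) (series_op mu)"

definition formal_isomorphism ::
  "('k::field \<Rightarrow> 'a::ab_group_add \<Rightarrow> 'a) \<Rightarrow> (nat \<Rightarrow> 'a \<Rightarrow> 'a) \<Rightarrow> bool" where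
  "formal_isomorphism s \<phi> \<longleftrightarrow> (\<forall>n. Vector_Spaces.linear s s (\<phi> n)) \<and> \<phi> 0 = id"

definition series_map :: "(nat \<Rightarrow> 'a \<Rightarrow> 'a) \<Rightarrow> 'a::ab_group_add fps \<Rightarrow> 'a fps" where
  "series_map \<phi> f = Abs_fps (\<lambda>n. \<Sum>i\<le>n. \<phi> i (fps_nth f (n - i)))"

text \<open>
  A formal isomorphism acts bijectively on \<open>A[[t]]\<close>, so \<open>inv (series_map \<phi>)\<close> below is a
  genuine two-sided inverse.
\<close>

fun series_map_preimage :: "(nat \<Rightarrow> 'a \<Rightarrow> 'a) \<Rightarrow> 'a::ab_group_add fps \<Rightarrow> nat \<Rightarrow> 'a" where
  "series_map_preimage \<phi> f n =
    fps_nth f n - (\<Sum>i\<in>{1..n}. \<phi> i (series_map_preimage \<phi> f (n - i)))"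

declare series_map_preimage.simps [simp del]

lemma series_map_nth:
  assumes "\<phi> 0 = id"
  shows "fps_nth (series_map \<phi> f) n = fps_nth f n + (\<Sum>i\<in>{1..n}. \<phi> i (fps_nth f (n - i)))"
proof -
  have "{..n} = insert 0 {1..n}" by auto
  then show ?thesis using assms by (simp add: series_map_def)
qed

lemma bij_series_map:
  assumes "formal_isomorphism s \<phi>"
  shows "bij (series_map \<phi>)"
proof -
  have \<phi>0: "\<phi> 0 = id" using assms by (simp add: formal_isomorphism_def)
  have "f = g" if eq: "series_map \<phi> f = series_map \<phi> g" for f g
  proof (rule fps_ext)
    fix n
    show "fps_nth f n = fps_nth g n"
    proof (induction n rule: less_induct)
      case (less n)
      have "(\<Sum>i\<in>{1..n}. \<phi> i (fps_nth f (n - i))) = (\<Sum>i\<in>{1..n}. \<phi> i (fps_nth g (n - i)))"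
        by (rule sum.cong) (auto simp: less)
      then show ?case
        using arg_cong[OF eq, of "\<lambda>h. fps_nth h n"] by (simp add: series_map_nth[where \<phi> = \<phi>, OF \<phi>0])
    qed
  qed
  moreover have "series_map \<phi> (Abs_fps (series_map_preimage \<phi> f)) = f" for f
  proof (rule fps_ext)
    fix n
    show "fps_nth (series_map \<phi> (Abs_fps (series_map_preimage \<phi> f))) n = fps_nth f n"
      by (simp add: series_map_nth[where \<phi> = \<phi>, OF \<phi>0] series_map_preimage.simps[of \<phi> f n])
  qed
  ultimately show ?thesis
    by (intro bijI injI surjI)
qed

definition transports ::
  "(nat \<Rightarrow> 'a \<Rightarrow> 'a) \<Rightarrow> (nat \<Rightarrow> 'a \<Rightarrow> 'a \<Rightarrow> 'a) \<Rightarrow> (nat \<Rightarrow> 'a \<Rightarrow> 'a \<Rightarrow> 'a::ab_group_add) \<Rightarrow> bool" where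
  "transports \<phi> \<theta> \<theta>' \<longleftrightarrow>
    (\<forall>x y. series_op \<theta>' (fps_const x) (fps_const y) =
      series_map \<phi> (series_op \<theta>
        (inv (series_map \<phi>) (fps_const x)) (inv (series_map \<phi>) (fps_const y))))"

definition equivalent_deformations ::
  "('k::field \<Rightarrow> 'a::ab_group_add \<Rightarrow> 'a) \<Rightarrow>
   (nat \<Rightarrow> 'a \<Rightarrow> 'a \<Rightarrow> 'a) \<Rightarrow> (nat \<Rightarrow> 'a \<Rightarrow> 'a \<Rightarrow> 'a) \<Rightarrow> (nat \<Rightarrow> 'a \<Rightarrow> 'a \<Rightarrow> 'a) \<Rightarrow>
   (nat \<Rightarrow> 'a \<Rightarrow> 'a \<Rightarrow> 'a) \<Rightarrow> (nat \<Rightarrow> 'a \<Rightarrow> 'a \<Rightarrow> 'a) \<Rightarrow> (nat \<Rightarrow> 'a \<Rightarrow> 'a \<Rightarrow> 'a) \<Rightarrow> bool" where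
  "equivalent_deformations s lam rho mu lam' rho' mu' \<longleftrightarrow>
    (\<exists>\<phi>. formal_isomorphism s \<phi> \<and>
      transports \<phi> lam lam' \<and> transports \<phi> rho rho' \<and> transports \<phi> mu mu')"

definition trivial_series :: "('a \<Rightarrow> 'a \<Rightarrow> 'a) \<Rightarrow> nat \<Rightarrow> 'a \<Rightarrow> 'a \<Rightarrow> 'a::ab_group_add" where
  "trivial_series B n = (if n = 0 then B else (\<lambda>x y. 0))"

definition rigid ::
  "('k::field \<Rightarrow> 'a::ab_group_add \<Rightarrow> 'a) \<Rightarrow>
   ('a \<Rightarrow> 'a \<Rightarrow> 'a) \<Rightarrow> ('a \<Rightarrow> 'a \<Rightarrow> 'a) \<Rightarrow> ('a \<Rightarrow> 'a \<Rightarrow> 'a) \<Rightarrow> bool" where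
  "rigid s L R M \<longleftrightarrow>
    (\<forall>lam rho mu. deformation s L R M lam rho mu \<longrightarrow>
      equivalent_deformations s lam rho mu (trivial_series L) (trivial_series R) (trivial_series M))"

end

theory Submission
  imports Defs
begin

text \<open>
  No cohomology is needed. For a deformation \<open>\<Theta>\<close> of \<open>A\<close>, the space \<open>A[[t]]\<close> is itself a
  triassociative algebra over \<open>K\<close> under the deformed products. If \<open>A\<close> is free on \<open>i : V \<rightarrow> A\<close>, the
  map \<open>v \<mapsto> i v\<close> into \<open>A[[t]]\<close> extends to a homomorphism \<open>\<Phi> : A \<rightarrow> A[[t]]\<close>. Its constant term
  is an endomorphism of \<open>A\<close> fixing the generators, hence the identity, so \<open>\<Phi>\<close> is a formal
  isomorphism, and its inverse carries \<open>\<Theta>\<close> to the trivial deformation.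
\<close>

lemma linear_apply_0:
  assumes "Vector_Spaces.linear s s' g"
  shows "g 0 = 0"
proof -
  interpret Vector_Spaces.linear s s' g by fact
  show ?thesis by (rule zero)
qed

lemma linear_sum_fun:
  assumes "vector_space s" "vector_space s'" "\<And>j. j \<in> X \<Longrightarrow> Vector_Spaces.linear s s' (h j)"
  shows "Vector_Spaces.linear s s' (\<lambda>x. \<Sum>j\<in>X. h j x)"
proof -
  interpret vector_space_pair s s' using assms(1,2) by (rule vector_space_pair.intro)
  show ?thesis using assms(3) by (rule linear_compose_sum[rule_format])
qed

section \<open>Extending identities from A to A[[t]]\<close>

definition fps_up :: "'a::ab_group_add fps \<Rightarrow> 'a fps" where
  "fps_up f = Abs_fps (\<lambda>n. case n of 0 \<Rightarrow> 0 | Suc m \<Rightarrow> fps_nth f m)"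

lemma fps_up_nth [simp]:
  "fps_nth (fps_up f) 0 = 0" "fps_nth (fps_up f) (Suc n) = fps_nth f n"
  by (simp_all add: fps_up_def)

lemma fps_const_plus_up: "f = fps_const (fps_nth f 0) + fps_up (fps_shift 1 f)"
proof (rule fps_ext)
  show "fps_nth f n = fps_nth (fps_const (fps_nth f 0) + fps_up (fps_shift 1 f)) n" for n
    by (cases n) simp_all
qed

text \<open>With \<open>fps_up\<close> as multiplication by t, this is Z[t]-bilinearity.\<close>

definition t_bilinear :: "('a::ab_group_add fps \<Rightarrow> 'a fps \<Rightarrow> 'a fps) \<Rightarrow> bool" where
  "t_bilinear P \<longleftrightarrow>
    (\<forall>f f' g. P (f + f') g = P f g + P f' g) \<and> (\<forall>f g g'. P f (g + g') = P f g + P f g') \<and>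
    (\<forall>f g. P (fps_up f) g = fps_up (P f g)) \<and> (\<forall>f g. P f (fps_up g) = fps_up (P f g))"

text \<open>Each of the eleven identities has this shape. Splitting an argument into its constant
  term and t times a series leaves a case with one more constant and a term with a factor t, whose
  coefficient in degree n comes from degree n - 1. Induction on n thus replaces t-adic
  continuity.\<close>

lemma t_bilinear_assoc_law:
  assumes "t_bilinear P" "t_bilinear Q" "t_bilinear P'" "t_bilinear Q'"
    and const: "\<And>x y z. P (Q (fps_const x) (fps_const y)) (fps_const z) =
      P' (fps_const x) (Q' (fps_const y) (fps_const z))"
  shows "P (Q f g) h = P' f (Q' g h)"
proof (rule fps_ext)
  fix n
  note simps = assms(1-4)[unfolded t_bilinear_def]
  let ?eq = "\<lambda>n f g h. fps_nth (P (Q f g) h) n = fps_nth (P' f (Q' g h)) n"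
  show "?eq n f g h"
  proof (induction n arbitrary: f g h rule: less_induct)
    case (less n)
    have up: "fps_nth (fps_up (P (Q f g) h)) n = fps_nth (fps_up (P' f (Q' g h))) n" for f g h
      by (cases n) (simp_all add: less)
    \<comment> \<open>Constants give way to arbitrary series one argument at a time, from the last
      to the first.\<close>
    have 1: "?eq n (fps_const x) (fps_const y) h" for x y
      by (subst (1 2) fps_const_plus_up[of h]) (simp add: simps const up)
    have 2: "?eq n (fps_const x) g h" for x
      by (subst (1 2) fps_const_plus_up[of g]) (simp add: simps 1 up)
    show ?case
      by (subst (1 2) fps_const_plus_up[of f]) (simp add: simps 2 up)
  qed
qed

lemma triassociative_on_range_fps_const_imp_UNIV:
  assumes L: "t_bilinear L" and R: "t_bilinear R" and M: "t_bilinear M"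
    and "triassociative_on (range fps_const) L R M"
  shows "triassociative_on UNIV L R M"
proof -
  note law = t_bilinear_assoc_law
  \<comment> \<open>The four letters instantiate P, Q, P', Q'; the facts follow the order of the
    eleven identities.\<close>
  note laws = law[OF L L L L] law[OF L L L R] law[OF L R R L] law[OF R L R R]
    law[OF R R R R] law[OF L L L M] law[OF L M M L] law[OF M L M R]
    law[OF M R R M] law[OF R M R R] law[OF M M M M]
  show ?thesis
    unfolding triassociative_on_def
    by (intro ballI conjI; rule laws; insert assms(4)[unfolded triassociative_on_def]; blast)
qed

section \<open>Deformed products on A[[t]]\<close>

lemma bilinear_op_simps:
  assumes "bilinear_op s B"
  shows "B (x + x') y = B x y + B x' y" "B x (y + y') = B x y + B x y'"
    "B (s c x) y = s c (B x y)" "B x (s c y) = s c (B x y)" "B 0 y = 0" "B x 0 = 0"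
  using assms linear_apply_0[of s s "\<lambda>x. B x y"] linear_apply_0[of s s "\<lambda>y. B x y"]
  by (simp_all add: bilinear_op_def Vector_Spaces.linear_iff)

lemma series_op_nth:
  "fps_nth (series_op \<theta> f g) n =
    (\<Sum>i\<le>n. \<Sum>j\<le>n - i. \<theta> i (fps_nth f j) (fps_nth g (n - i - j)))"
  by (simp add: series_op_def)

lemma t_bilinear_series_op:
  assumes "\<And>n. bilinear_op s (\<theta> n)"
  shows "t_bilinear (series_op \<theta>)"
proof -
  note simps = bilinear_op_simps[OF assms]
  have "fps_nth (series_op \<theta> (fps_up f) g) n = fps_nth (fps_up (series_op \<theta> f g)) n" for f g n
  proof (cases n)
    case (Suc m)
    \<comment> \<open>The summand j = 0 vanishes because \<open>fps_up f\<close> has no constant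
      term; the others are reindexed by one.\<close>
    have "(\<Sum>j\<le>Suc m - i. \<theta> i (fps_nth (fps_up f) j) (fps_nth g (Suc m - i - j))) =
        (\<Sum>j\<le>m - i. \<theta> i (fps_nth f j) (fps_nth g (m - i - j)))" if "i \<le> m" for i
      using that by (simp add: Suc_diff_le sum.atMost_Suc_shift simps del: sum.atMost_Suc)
    then show ?thesis by (simp add: Suc series_op_nth simps)
  qed (simp add: series_op_nth simps)
  moreover have "fps_nth (series_op \<theta> f (fps_up g)) n = fps_nth (fps_up (series_op \<theta> f g)) n" for f g n
  proof (cases n)
    case (Suc m)
    \<comment> \<open>Here the last summand vanishes, so the index j stays as it is.\<close>
    have "(\<Sum>j\<le>Suc m - i. \<theta> i (fps_nth f j) (fps_nth (fps_up g) (Suc m - i - j))) =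
        (\<Sum>j\<le>m - i. \<theta> i (fps_nth f j) (fps_nth g (m - i - j)))" if "i \<le> m" for i
      using that by (simp add: Suc_diff_le simps)
    then show ?thesis by (simp add: Suc series_op_nth simps)
  qed (simp add: series_op_nth simps)
  ultimately show ?thesis
    by (auto simp: t_bilinear_def series_op_nth simps sum.distrib intro!: fps_ext)
qed

text \<open>Scalars stay in K rather than K[[t]], since A[[t]] is to be a target of the universal
  property over K.\<close>

definition fps_scale :: "('k \<Rightarrow> 'a \<Rightarrow> 'a) \<Rightarrow> 'k \<Rightarrow> 'a::ab_group_add fps \<Rightarrow> 'a fps" where
  "fps_scale s c f = Abs_fps (\<lambda>n. s c (fps_nth f n))"

lemma fps_scale_nth [simp]: "fps_nth (fps_scale s c f) n = s c (fps_nth f n)"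
  by (simp add: fps_scale_def)

lemma vector_space_fps_scale:
  assumes "vector_space s"
  shows "vector_space (fps_scale s)"
proof -
  interpret vector_space s by fact
  show ?thesis
    by unfold_locales (simp_all add: fps_eq_iff scale_right_distrib scale_left_distrib)
qed

lemma bilinear_op_series_op:
  assumes vs: "vector_space s" and \<theta>: "\<And>n. bilinear_op s (\<theta> n)"
  shows "bilinear_op (fps_scale s) (series_op \<theta>)"
proof -
  interpret vector_space s by fact
  show ?thesis
    using t_bilinear_series_op[of s \<theta>, OF \<theta>] vector_space_fps_scale[OF vs]
    by (simp add: bilinear_op_def Vector_Spaces.linear_iff t_bilinear_def fps_eq_iff
        series_op_nth bilinear_op_simps[OF \<theta>] scale_sum_right)
qed

text \<open>A deformation satisfies the identities on constants only; t-bilinearity of the products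
  carries them to all of A[[t]].\<close>

lemma deformation_triassociative_algebra:
  assumes "vector_space s" "deformation s L R M lam rho mu"
  shows "triassociative_algebra (fps_scale s) (series_op lam) (series_op rho) (series_op mu)"
proof -
  have bil: "bilinear_op s (lam n)" "bilinear_op s (rho n)" "bilinear_op s (mu n)" for n
    using assms(2) by (simp_all add: deformation_def)
  moreover have "triassociative_on (range fps_const) (series_op lam) (series_op rho) (series_op mu)"
    using assms(2) by (simp add: deformation_def)
  ultimately have "triassociative_on UNIV (series_op lam) (series_op rho) (series_op mu)"
    by (intro triassociative_on_range_fps_const_imp_UNIV t_bilinear_series_op[of s])
  then show ?thesis
    using assms(1) bil
    by (simp add: triassociative_algebra_def vector_space_fps_scale bilinear_op_series_op)
qed

section \<open>Inverting a formal isomorphism\<close>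

fun formal_left_inverse :: "(nat \<Rightarrow> 'a \<Rightarrow> 'a) \<Rightarrow> nat \<Rightarrow> 'a \<Rightarrow> 'a::ab_group_add" where
  "formal_left_inverse \<phi> n x =
    (if n = 0 then x else - (\<Sum>j<n. formal_left_inverse \<phi> j (\<phi> (n - j) x)))"

declare formal_left_inverse.simps [simp del]

lemma formal_isomorphism_left_inverse:
  assumes vs: "vector_space s" and \<phi>: "formal_isomorphism s \<phi>"
  shows "formal_isomorphism s (formal_left_inverse \<phi>)"
proof -
  interpret vector_space s by fact
  have "Vector_Spaces.linear s s (formal_left_inverse \<phi> n)" for n
  proof (induction n rule: less_induct)
    case (less n)
    have "Vector_Spaces.linear s s (\<lambda>x. \<Sum>j<n. formal_left_inverse \<phi> j (\<phi> (n - j) x))"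
      using less \<phi>
      by (intro linear_sum_fun[OF vs vs]) (simp add: formal_isomorphism_def Vector_Spaces.linear_iff)
    then show ?case
      using vs by (simp add: Vector_Spaces.linear_iff formal_left_inverse.simps[of \<phi> n]
          scale_right_diff_distrib)
  qed
  then show ?thesis
    by (simp add: formal_isomorphism_def fun_eq_iff formal_left_inverse.simps[of \<phi> 0])
qed

text \<open>The series on the left is \<Phi>(x). The recursion of \<open>formal_left_inverse\<close>
  is the degree n part of \<Psi>\<Phi> = id solved for \<psi>_n: as \<phi>_0 = id, the summand i = n
  is \<psi>_n(x), which cancels all others when n > 0.\<close>

lemma series_map_formal_left_inverse:
  assumes "\<phi> 0 = id"
  shows "series_map (formal_left_inverse \<phi>) (Abs_fps (\<lambda>n. \<phi> n x)) = fps_const x"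
proof (rule fps_ext)
  fix n :: nat
  have "{..n} = insert n {..<n}" by auto
  then show "fps_nth (series_map (formal_left_inverse \<phi>) (Abs_fps (\<lambda>n. \<phi> n x))) n =
      fps_nth (fps_const x) n"
    using assms by (simp add: series_map_def formal_left_inverse.simps[of \<phi> n])
qed

section \<open>Transport to the trivial deformation\<close>

lemma series_op_trivial_series:
  assumes "bilinear_op s B"
  shows "series_op (trivial_series B) (fps_const x) (fps_const y) = fps_const (B x y)"
proof (rule fps_ext)
  fix n :: nat
  have 1: "fps_nth (series_op (trivial_series B) (fps_const x) (fps_const y)) n =
      (\<Sum>i\<in>{0::nat}. \<Sum>j\<le>n. B (fps_nth (fps_const x) j) (fps_nth (fps_const y) (n - j)))"
    unfolding series_op_nth by (rule sum.mono_neutral_cong_right) (auto simp: trivial_series_def)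
  have 2: "(\<Sum>j\<le>n. B (fps_nth (fps_const x) j) (fps_nth (fps_const y) (n - j))) =
      (\<Sum>j\<in>{0}. B (fps_nth (fps_const x) j) (fps_nth (fps_const y) (n - j)))"
    by (rule sum.mono_neutral_right) (auto simp: bilinear_op_simps[OF assms])
  show "fps_nth (series_op (trivial_series B) (fps_const x) (fps_const y)) n =
      fps_nth (fps_const (B x y)) n"
    unfolding 1 2 by (simp add: bilinear_op_simps[OF assms])
qed

text \<open>Here \<open>g\<close> is \<Psi>^{-1} restricted to A, so \<Psi> applied to the deformed
  product of \<open>g x\<close> and \<open>g y\<close> is \<Psi>(g(B x y)), the constant B x
  y.\<close>

lemma transports_trivial_series:
  assumes B: "bilinear_op s B" and \<psi>: "formal_isomorphism s \<psi>"
    and inv: "\<And>x. series_map \<psi> (g x) = fps_const x"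
    and hom: "\<And>x y. g (B x y) = series_op \<theta> (g x) (g y)"
  shows "transports \<psi> \<theta> (trivial_series B)"
proof -
  have "inv (series_map \<psi>) (fps_const x) = g x" for x
    using bij_series_map[OF \<psi>] inv by (metis bij_is_inj inv_f_f)
  then show ?thesis
    by (simp add: transports_def series_op_trivial_series[OF B] inv flip: hom)
qed

theorem corollary4p7:
  fixes sV :: "'k::field \<Rightarrow> 'v::ab_group_add \<Rightarrow> 'v"
    and s :: "'k \<Rightarrow> 'a::ab_group_add \<Rightarrow> 'a"
    and L R M :: "'a \<Rightarrow> 'a \<Rightarrow> 'a"
    and i :: "'v \<Rightarrow> 'a"
  assumes "vector_space sV"
    and "free_triassociative_algebra sV s L R M i"
  shows "rigid s L R M"
  unfolding rigid_def
proof (intro allI impI)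
  fix lam rho mu
  assume def: "deformation s L R M lam rho mu"
  have A: "triassociative_algebra s L R M" and i: "Vector_Spaces.linear sV s i"
    and UA: "universal_at TYPE('a) sV s L R M i"
    using assms(2) by (auto simp: free_triassociative_algebra_def)
  interpret vector_space s using A by (simp add: triassociative_algebra_def)
  have vs: "vector_space s" and bil: "bilinear_op s L" "bilinear_op s R" "bilinear_op s M"
    using A by (auto simp: triassociative_algebra_def)
  have zero: "lam 0 = L" "rho 0 = R" "mu 0 = M" using def by (auto simp: deformation_def)
  have "Vector_Spaces.linear sV (fps_scale s) (\<lambda>v. fps_const (i v))"
    using i vector_space_fps_scale[OF vs] by (simp add: Vector_Spaces.linear_iff fps_eq_iff)
  \<comment> \<open>The definition of freeness does not list the type of A[[t]] among its targets,
    hence \<open>free_imp_universal_at\<close>.\<close>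
  then obtain g
    where g: "triassociative_hom s L R M (fps_scale s) (series_op lam) (series_op rho) (series_op mu) g"
      and gi: "\<And>v. g (i v) = fps_const (i v)"
    using free_imp_universal_at[OF assms(2), where 'c = "'a fps"]
      deformation_triassociative_algebra[OF vs def]
    unfolding universal_at_def by metis
  define \<phi> where "\<phi> = (\<lambda>n x. fps_nth (g x) n)"
  have g_eq: "g x = Abs_fps (\<lambda>n. \<phi> n x)" for x
    by (simp add: \<phi>_def fps_eq_iff)
  have lin: "Vector_Spaces.linear s s (\<phi> n)" for n
    using g vs by (simp add: triassociative_hom_def Vector_Spaces.linear_iff \<phi>_def)
  \<comment> \<open>In degree 0 only \<open>lam 0\<close>, \<open>rho 0\<close>, \<open>mu 0\<close>
    contribute, so taking constant terms is a homomorphism from A[[t]] to A.\<close>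
  have "triassociative_hom s L R M s L R M (\<phi> 0)"
    using g lin by (simp add: triassociative_hom_def \<phi>_def series_op_nth zero)
  moreover have "triassociative_hom s L R M s L R M id"
    using vs by (simp add: triassociative_hom_def Vector_Spaces.linear_iff)
  moreover have "\<phi> 0 (i v) = i v" for v
    by (simp add: \<phi>_def gi)
  ultimately have \<phi>0: "\<phi> 0 = id"
    using UA[unfolded universal_at_def, rule_format, OF A i] by (metis id_apply)
  have \<psi>: "formal_isomorphism s (formal_left_inverse \<phi>)"
    using lin \<phi>0 by (intro formal_isomorphism_left_inverse[OF vs]) (simp add: formal_isomorphism_def)
  have inv: "series_map (formal_left_inverse \<phi>) (g x) = fps_const x" for x
    unfolding g_eq by (rule series_map_formal_left_inverse) (rule \<phi>0)
  \<comment> \<open>The equivalence runs from the given deformation to the trivial one, so the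
    witness is the inverse of \<Phi>, not \<Phi>.\<close>
  show "equivalent_deformations s lam rho mu (trivial_series L) (trivial_series R) (trivial_series M)"
    unfolding equivalent_deformations_def
    using g by (intro exI[of _ "formal_left_inverse \<phi>"] conjI \<psi>
        transports_trivial_series[OF bil(1) \<psi> inv] transports_trivial_series[OF bil(2) \<psi> inv]
        transports_trivial_series[OF bil(3) \<psi> inv]) (simp_all add: triassociative_hom_def)
qed

end
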